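(* For all integers $m,n>0$ and all integers $0\le a\le n-1$, $0\le b\le a$, $$d(-m;n,1,a,b)=(-1)^{n-1-a}\,p(m;n,1,a,b).$$
   Context: For integers $m$ (possibly negative) and $n,t,a,b$ put $$d(m;n,t,a,b)=\binom{n-b-2}{a-b}\binom{mn-t+1}{n-t-a}-m\binom{n-b-1}{a-b}\binom{mn-t}{n-t-a-1},$$ $$p(m;n,t,a,b)=\left(\frac{t+a}{n}-\frac{a-b}{n-b-1}\right)\binom{n-b-1}{a-b}\binom{mn+n-t-a-1}{n-t-a}.$$ Binomial coefficients are polynomials in the upper argument: $\binom{z}{k}=z(z-1)\cdots(z-k+1)/k!$ for $k\ge0$ and $\binom{z}{k}=0$ for $k<0$; the fraction $\frac{a-b}{n-b-1}$ is read as $0$ when $a=b=n-1$. For $m>0$, $d(m;n,1,a,b)$ is the number of $(m,1)$-Dyck paths of height $n$ with exactly $a$ valleys whose $x$-coordinate is divisible by $m$ and exactly $b$ returns, and $p(m;n,1,a,b)$ is the number of positive $(m,1)$-Schröder paths of height $n$ all of whose diagonal steps end at $x$-coordinates divisible by $m$, with exactly $a$ diagonal steps and $b$ diagonal steps of the form $(im-1,i)\to(im,i+1)$. Here an $(m,1)$-Dyck path (resp. $(m,1)$-Schröder path) of height $n$ is a lattice path from $(0,0)$ to $(mn,n)$ with steps $(0,1),(1,0)$ (resp. $(0,1),(1,0),(1,1)$) starting with a step $(0,1)$ and never going below $x=my$; a valley is a point preceded by a step $(1,0)$ and followed by a step $(0,1)$; a return is a valley of the form $(mi,i)$; and positive means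 touching $x=my$ only at the two endpoints. *)

theory Defs
  imports Complex_Main
begin

text \<open>
  Binomial coefficient with integer upper and lower arguments: polynomial in the upper argument,
  zero for a negative lower argument. Values are rational because \<open>path_p\<close> involves
  genuine fractions.
\<close>

definition ibinom :: "int \<Rightarrow> int \<Rightarrow> rat" where
  "ibinom z k = (if k < 0 then 0 else of_int z gchoose nat k)"

definition path_d :: "int \<Rightarrow> int \<Rightarrow> int \<Rightarrow> int \<Rightarrow> int \<Rightarrow> rat" where
  "path_d m n t a b =
     ibinom (n - b - 2) (a - b) * ibinom (m * n - t + 1) (n - t - a)
     - of_int m * ibinom (n - b - 1) (a - b) * ibinom (m * n - t) (n - t - a - 1)"

text \<open>
  For \<open>a = b = n - 1\<close> the fraction with denominator \<open>n - b - 1\<close> is \<open>0 / 0\<close>,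
  which is \<open>0\<close> in HOL; this is exactly the intended reading.
\<close>

definition path_p :: "int \<Rightarrow> int \<Rightarrow> int \<Rightarrow> int \<Rightarrow> int \<Rightarrow> rat" where
  "path_p m n t a b =
     (of_int (t + a) / of_int n - of_int (a - b) / of_int (n - b - 1))
     * ibinom (n - b - 1) (a - b) * ibinom (m * n + n - t - a - 1) (n - t - a)"

end

theory Submission
  imports Defs
begin

text \<open>
  Put \<open>k = n - 1 - a\<close>, \<open>j = a - b\<close>, \<open>N = n - b - 1 = k + j\<close> and \<open>X = binom(m n + k - 1, k)\<close>.
  For \<open>k > 0\<close>, negating the upper arguments and absorbing turns both sides into
  \<open>(-1)^k (k / N - k / n) binom(N, j) X\<close>: the factor \<open>k / N\<close> comes from
  \<open>N binom(N - 1, j) = (N - j) binom(N, j)\<close> and \<open>k / n\<close> from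
  \<open>m n binom(m n + k - 1, k - 1) = k X\<close>.
\<close>

lemma gbinomial_uminus:
  "(- x :: 'a :: field_char_0) gchoose k = (- 1) ^ k * ((x + of_nat k - 1) gchoose k)"
  by (subst gbinomial_negated_upper) (simp add: algebra_simps)

lemma gbinomial_absorb_lower:
  "x * ((x + of_nat i) gchoose i) = of_nat (Suc i) * ((x + of_nat i :: 'a :: field_char_0) gchoose Suc i)"
  using gbinomial_mult_1[of "x + of_nat i" i] by (simp add: algebra_simps)

lemma ibinom_of_nat: "ibinom z (int k) = of_int z gchoose k"
  by (simp add: ibinom_def)

theorem theorem4p1:
  fixes m n a b :: int
  assumes "m > 0" and "n > 0"
    and "0 \<le> a" and "a \<le> n - 1"
    and "0 \<le> b" and "b \<le> a"
  shows "path_d (- m) n 1 a b = (- 1) ^ nat (n - 1 - a) * path_p m n 1 a b"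
proof -
  obtain k where k: "n - 1 - a = int k"
    using assms(4) by (metis diff_ge_0_iff_ge nonneg_int_cases)
  obtain j where j: "a - b = int j"
    using assms(6) by (metis diff_ge_0_iff_ge nonneg_int_cases)
  have a: "a = n - 1 - int k" and b: "b = n - 1 - int k - int j"
    using k j by linarith+
  define N where "N = (of_nat (k + j) :: rat)"
  define M where "M = (of_int (m * n) :: rat)"
  define C where "C = N gchoose j"
  define X where "X = (M + of_nat k - 1) gchoose k"
  have n: "of_int n \<noteq> (0 :: rat)"
    using assms(2) by simp
  have p: "path_p m n 1 a b = (of_int (n - int k) / of_int n - of_nat j / N) * C * X"
    unfolding path_p_def a b C_def X_def M_def N_def
    by (simp add: ibinom_of_nat algebra_simps)
  \<comment> \<open>At \<open>t = 1\<close> the first upper argument is \<open>- M\<close>; folding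
    \<open>(- 1) ^ k * X\<close> back into \<open>- M gchoose k\<close> matches it.\<close>
  have d1: "path_d (- m) n 1 a b
      = ((N - 1) gchoose j) * ((- 1) ^ k * X) + of_int m * C * ibinom (- (m * n) - 1) (int k - 1)"
    unfolding path_d_def a b C_def X_def M_def N_def gbinomial_uminus[symmetric]
    by (simp add: ibinom_of_nat algebra_simps)
  show ?thesis
  proof (cases k)
    case 0
    \<comment> \<open>Here \<open>N = j\<close>, so \<open>1 - j / N\<close> is the same indicator
      of \<open>j = 0\<close>, by \<open>0 / 0 = 0\<close>.\<close>
    have "(N - 1) gchoose j = (if j = 0 then 1 else 0)"
      using 0 by (cases j) (auto simp: N_def binomial_gbinomial[symmetric])
    then show ?thesis
      unfolding k d1 p using 0 n by (simp add: ibinom_def C_def X_def N_def)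
  next
    case (Suc i)
    have N: "N \<noteq> 0"
      using Suc by (simp add: N_def del: of_nat_add)
    \<comment> \<open>The minus sign comes from \<open>(- 1) ^ i = - ((- 1) ^ k)\<close>.\<close>
    have "ibinom (- (m * n) - 1) (int k - 1) = - ((- 1) ^ k * ((M + of_nat i) gchoose i))"
      using Suc gbinomial_uminus[of "M + 1" i] by (simp add: ibinom_of_nat M_def)
    moreover have "(M + of_nat i) gchoose i = of_nat k * X / M"
      using gbinomial_absorb_lower[of M i] Suc assms(1,2)
      by (simp add: X_def M_def field_simps)
    moreover have "(N - 1) gchoose j = of_nat k * C / N"
      using gbinomial_absorb_comp[of N j] N by (simp add: C_def N_def field_simps)
    ultimately have "path_d (- m) n 1 a b = (- 1) ^ k * (of_nat k / N - of_nat k / of_int n) * C * X"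
      unfolding d1 using assms(1) n by (simp add: M_def algebra_simps)
    \<comment> \<open>Both fractions are complements to 1, since \<open>N = k + j\<close>.\<close>
    moreover have "of_int (n - int k) / of_int n - of_nat j / N = of_nat k / N - of_nat k / of_int n"
      using n N by (simp add: N_def field_simps)
    ultimately show ?thesis
      unfolding k p by simp
  qed
qed

end
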